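(* Let $H_n^{(3)}=\sum_{j=1}^n \frac{1}{j^3}$ and $(x)_k=x(x+1)\cdots(x+k-1)$ (with $(x)_0=1$). Then \[ \sum_{k=1}^{\infty}(-1)^k(4k+1)\frac{(\frac{1}{2})_k^3}{(1)_k^3}H_{2k}^{(3)}=\frac{15\zeta(3)}{4\pi}-2G, \] where $\zeta(3)=\sum_{k=1}^{\infty}\frac{1}{k^3}$ and $G=\sum_{k=1}^{\infty}\frac{(-1)^{k-1}}{(2k-1)^2}$ is Catalan's constant.
   Context: $(x)_k$ denotes the rising factorial (shifted factorial). $H_n^{(3)}$ is the harmonic number of order 3. *)

theory Defs
  imports "HOL-Analysis.Analysis"
begin

definition harmonic_order :: "nat \<Rightarrow> nat \<Rightarrow> real" where
  "harmonic_order r n = (\<Sum>j=1..n. 1 / real j ^ r)"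

(* The series below start at index 1, hence the shift by Suc. *)

definition zeta3 :: real where
  "zeta3 = (\<Sum>k. 1 / real (Suc k) ^ 3)"

definition Catalan_const :: real where
  "Catalan_const = (\<Sum>k. (- 1) ^ (Suc k - 1) / (2 * real (Suc k) - 1) ^ 2)"

end

theory Submission
  imports Defs "HOL-Real_Asymp.Real_Asymp"
begin

text \<open>
  With \<open>c\<^sub>k = (1/2)\<^sub>k / k!\<close> and \<open>a\<^sub>k = (-1)\<^sup>k (4 k + 1) c\<^sub>k\<^sup>3\<close>, damp the series by the factors
  \<open>W(n,k) = (-n)\<^sub>k (-1)\<^sup>k / (n + 3/2)\<^sub>k\<close>. The terms \<open>a\<^sub>k W(n,k)\<close> form a WZ pair after division by
  \<open>F(n) = (2 n + 1) c\<^sub>n\<^sup>2\<close>, so \<open>\<Sum>\<^sub>k a\<^sub>k W(n,k) = F(n)\<close>. Summation by parts against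
  \<open>8 H\<^sub>2\<^sub>k\<close> (harmonic numbers of order 3) leaves a sum which telescopes back to the first
  identity, and gives the finite form
  \<open>8 \<Sum>\<^sub>k a\<^sub>k W(n,k) H\<^sub>2\<^sub>k = F(n) (H\<^sub>n - \<Sum>\<^bsub>m \<le> n\<^esub> 1 / (m\<^sup>3 c\<^sub>m\<^sup>2))\<close>.
  As \<open>n \<rightarrow> \<infinity>\<close>, \<open>F(n) \<rightarrow> 2 / \<pi>\<close> by Wallis' product. The remaining series is
  \<open>4 \<integral> x\<^sup>2 / sin x\<close> over \<open>[0, \<pi>/2]\<close> by the power series of \<open>arcsin\<^sup>2\<close>; expanding \<open>1 / sin x\<close> as
  \<open>2 \<Sum> sin ((2 j + 1) x)\<close> instead evaluates that integral to \<open>2 \<pi> G - 7/2 \<zeta>(3)\<close>.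
\<close>

subsection \<open>The finite identities\<close>

definition central :: "nat \<Rightarrow> real" where
  "central n = pochhammer (1 / 2) n / fact n"

text \<open>Subtraction is in the reals: the factor \<open>j = n\<close> vanishes exactly, which
  cuts every damped sum off at \<open>k = n\<close>.\<close>

definition damp :: "nat \<Rightarrow> nat \<Rightarrow> real" where
  "damp n k = (\<Prod>j<k. (real n - real j) / (real n + 3 / 2 + real j))"

text \<open>The terms of Bauer's alternating series for 2/pi.\<close>

definition bauer :: "nat \<Rightarrow> real" where
  "bauer k = (-1) ^ k * (4 * real k + 1) * central k ^ 3"

text \<open>The WZ mate of \<open>bauer k * damp n k\<close>, shifted by one in \<open>k\<close> to avoid the pole at \<open>k = n + 1\<close>.\<close>
definition flux :: "nat \<Rightarrow> nat \<Rightarrow> real" where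
  "flux n k = (-1) ^ k * central k ^ 3 * damp n k * (real k + 1 / 2) ^ 3 / (real n + real k + 3 / 2)"

lemma central_0 [simp]: "central 0 = 1"
  by (simp add: central_def)

lemma central_Suc: "central (Suc n) = central n * (real n + 1 / 2) / (real n + 1)"
  by (simp add: central_def pochhammer_Suc field_simps)

lemma central_pos: "central n > 0"
  by (simp add: central_def pochhammer_pos)

lemma damp_0 [simp]: "damp n 0 = 1"
  by (simp add: damp_def)

lemma damp_Suc: "damp n (Suc k) = damp n k * (real n - real k) / (real n + real k + 3 / 2)"
  by (simp add: damp_def algebra_simps)

lemma damp_eq_0: "k > n \<Longrightarrow> damp n k = 0"
  by (auto simp: damp_def)

text \<open>Shifting both indices adds only \<open>n + 1\<close> to the numerator; the denominator
  loses its first factor \<open>n + 3 / 2\<close> and gains two at the end. Thus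
  \<open>damp n k\<close> can be factored out of the WZ relation.\<close>

lemma damp_Suc_Suc:
  "damp (Suc n) (Suc k) =
     damp n k * (real n + 1) * (real n + 3 / 2) / ((real n + real k + 3 / 2) * (real n + real k + 5 / 2))"
proof (induction k)
  case 0
  have "real n + 3 / 2 \<noteq> 0" "real n + 5 / 2 \<noteq> 0" by linarith+
  then show ?case by (simp add: damp_Suc add_ac)
next
  case (Suc k)
  have ne: "real n + real k + 3 / 2 \<noteq> 0" "real n + real k + 5 / 2 \<noteq> 0" "real n + real k + 7 / 2 \<noteq> 0"
    by linarith+
  have "damp (Suc n) (Suc (Suc k)) = damp (Suc n) (Suc k) * (real n - real k) / (real n + real k + 7 / 2)"
    by (subst damp_Suc) (simp add: algebra_simps)
  also have "\<dots> = (damp n k * (real n - real k) / (real n + real k + 3 / 2)) * (real n + 1) * (real n + 3 / 2)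
      / ((real n + real k + 5 / 2) * (real n + real k + 7 / 2))"
    using ne by (simp add: Suc field_simps)
  also have "damp n k * (real n - real k) / (real n + real k + 3 / 2) = damp n (Suc k)"
    by (simp add: damp_Suc)
  finally show ?case by (simp add: algebra_simps)
qed

section \<open>The WZ relation and its summation\<close>

text \<open>The unshifted mate vanishes at index 0, so only \<open>flux n 0\<close> stands on the
  right. The coefficient on the left is \<open>norm_factor n / norm_factor (Suc n)\<close>.\<close>

lemma flux_0_step:
  "(real n + 1) ^ 2 / ((real n + 3 / 2) * (real n + 1 / 2)) * (bauer 0 * damp (Suc n) 0) - bauer 0 * damp n 0
     = 2 / (real n + 1 / 2) * flux n 0"
proof -
  have "real n + 3 / 2 \<noteq> 0" "real n + 1 / 2 \<noteq> 0" by linarith+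
  then show ?thesis
    by (simp add: bauer_def flux_def divide_simps power2_eq_square power3_eq_cube) (simp add: algebra_simps)
qed

text \<open>The WZ relation at index \<open>k + 1\<close> divided by
  \<open>(-1) ^ k * central k ^ 3 * damp n k\<close>, which leaves an identity of rational
  functions.\<close>

lemma flux_certificate:
  fixes n k :: real
  assumes "n \<ge> 0" "k \<ge> 0"
  shows "(n + 1) ^ 2 / ((n + 3 / 2) * (n + 1 / 2)) *
      (- (4 * (k + 1) + 1) * ((k + 1 / 2) / (k + 1)) ^ 3 *
        ((n + 1) * (n + 3 / 2) / ((n + k + 3 / 2) * (n + k + 5 / 2))))
      + (4 * (k + 1) + 1) * ((k + 1 / 2) / (k + 1)) ^ 3 * ((n - k) / (n + k + 3 / 2))
    = 2 / (n + 1 / 2) * (- (((k + 1 / 2) / (k + 1)) ^ 3) * ((n - k) / (n + k + 3 / 2))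
        * (k + 3 / 2) ^ 3 / (n + k + 5 / 2) - (k + 1 / 2) ^ 3 / (n + k + 3 / 2))"
proof -
  have nz: "k + 1 \<noteq> 0" "n + 3 / 2 \<noteq> 0" "n + 1 / 2 \<noteq> 0" "n + k + 3 / 2 \<noteq> 0" "n + k + 5 / 2 \<noteq> 0"
    using assms by linarith+
  \<comment> \<open>Writing \<open>(k + 1 / 2) ^ 3\<close> as \<open>q * (k + 1) ^ 3\<close> lets
    \<open>q\<close> factor out of both sides without expanding its cubes.\<close>
  define q where "q = (k + 1 / 2) ^ 3 / (k + 1) ^ 3"
  define a b c where "a = n + 1 / 2" and "b = n + k + 3 / 2" and "c = n + k + 5 / 2"
  have q: "(k + 1 / 2) ^ 3 = q * (k + 1) ^ 3" using nz by (simp add: q_def)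
  have q': "((k + 1 / 2) / (k + 1)) ^ 3 = q" by (simp add: q_def power_divide)
  have nz': "a \<noteq> 0" "b \<noteq> 0" "c \<noteq> 0" using nz by (auto simp: a_def b_def c_def)
  have "(n + 1) ^ 2 / ((n + 3 / 2) * a) * (- (4 * (k + 1) + 1) * q * ((n + 1) * (n + 3 / 2) / (b * c)))
      + (4 * (k + 1) + 1) * q * ((n - k) / b)
     = q * (4 * k + 5) * ((n - k) * a * c - (n + 1) ^ 3) / (a * b * c)"
    using nz nz' by (simp add: divide_simps power2_eq_square power3_eq_cube) (simp add: algebra_simps)
  \<comment> \<open>The polynomial identity behind the certificate, once \<open>q\<close> and the
    denominators are removed.\<close>
  also have "(4 * k + 5) * ((n - k) * a * c - (n + 1) ^ 3)
      = - 2 * ((n - k) * (k + 3 / 2) ^ 3 + (k + 1) ^ 3 * c)"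
    by (simp add: a_def c_def field_simps power2_eq_square power3_eq_cube)
  hence "q * (4 * k + 5) * ((n - k) * a * c - (n + 1) ^ 3) / (a * b * c)
      = q * (- 2 * ((n - k) * (k + 3 / 2) ^ 3 + (k + 1) ^ 3 * c)) / (a * b * c)"
    by (simp add: mult.assoc)
  also have "\<dots> = 2 / a * (- q * ((n - k) / b) * (k + 3 / 2) ^ 3 / c - q * (k + 1) ^ 3 / b)"
    using nz' by (simp add: divide_simps) (simp add: algebra_simps)
  finally show ?thesis
    unfolding q' q a_def b_def c_def .
qed

lemma flux_Suc_step:
  "(real n + 1) ^ 2 / ((real n + 3 / 2) * (real n + 1 / 2)) * (bauer (Suc k) * damp (Suc n) (Suc k))
     - bauer (Suc k) * damp n (Suc k)
   = 2 / (real n + 1 / 2) * (flux n (Suc k) - flux n k)"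
proof -
  define y where "y = (-1) ^ k * central k ^ 3 * damp n k"
  let ?n = "real n" and ?k = "real k"
  have b: "bauer (Suc k) = - ((-1) ^ k * central k ^ 3 * ((4 * (?k + 1) + 1) * ((?k + 1 / 2) / (?k + 1)) ^ 3))"
    by (simp add: bauer_def central_Suc power_mult_distrib power_divide)
  have ring: "- (s * c * (m * q)) * (d * t) = s * c * d * (- m * q * t)"
      "- (s * c * (m * q)) * (d * t) = - (s * c * d) * (m * q * t)" for s c m q d t :: real
    by (simp_all add: mult_ac)
  have d1: "damp (Suc n) (Suc k) = damp n k * ((?n + 1) * (?n + 3 / 2) / ((?n + ?k + 3 / 2) * (?n + ?k + 5 / 2)))"
    by (simp add: damp_Suc_Suc mult.assoc)
  have d2: "damp n (Suc k) = damp n k * ((?n - ?k) / (?n + ?k + 3 / 2))"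
    by (simp add: damp_Suc)
  have 1: "bauer (Suc k) * damp (Suc n) (Suc k) = y * (- (4 * (?k + 1) + 1) * ((?k + 1 / 2) / (?k + 1)) ^ 3 *
        ((?n + 1) * (?n + 3 / 2) / ((?n + ?k + 3 / 2) * (?n + ?k + 5 / 2))))"
    unfolding b d1 y_def by (rule ring)
  have 2: "bauer (Suc k) * damp n (Suc k) =
     - y * ((4 * (?k + 1) + 1) * ((?k + 1 / 2) / (?k + 1)) ^ 3 * ((?n - ?k) / (?n + ?k + 3 / 2)))"
    unfolding b d2 y_def by (rule ring)
  have 3: "flux n (Suc k) = y * (- (((?k + 1 / 2) / (?k + 1)) ^ 3) * ((?n - ?k) / (?n + ?k + 3 / 2))
        * (?k + 3 / 2) ^ 3 / (?n + ?k + 5 / 2))"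
  proof -
    have e: "?n + real (Suc k) + 3 / 2 = ?n + ?k + 5 / 2" "real (Suc k) + 1 / 2 = ?k + 3 / 2" by simp_all
    show ?thesis unfolding flux_def e
      by (simp add: y_def central_Suc damp_Suc power_mult_distrib power_divide)
  qed
  have 4: "flux n k = y * ((?k + 1 / 2) ^ 3 / (?n + ?k + 3 / 2))"
    by (simp add: flux_def y_def)
  have comb: "p * (y * e) - - y * f = r * (y * g - y * m)" if "p * e + f = r * (g - m)" for p e f r g m :: real
    using arg_cong[OF that, of "\<lambda>t. y * t"] by (simp add: algebra_simps)
  show ?thesis
    unfolding 1 2 3 4 by (rule comb, rule flux_certificate) simp_all
qed

text \<open>Abel summation of the WZ relation. The weight \<open>h\<close> is arbitrary because both
  a constant and the harmonic numbers are inserted below.\<close>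

lemma flux_sum:
  "(real n + 1) ^ 2 / ((real n + 3 / 2) * (real n + 1 / 2)) * (\<Sum>k\<le>K. bauer k * damp (Suc n) k * h k)
     - (\<Sum>k\<le>K. bauer k * damp n k * h k)
   = 2 / (real n + 1 / 2) * (flux n K * h K - (\<Sum>k<K. flux n k * (h (Suc k) - h k)))"
proof (induction K)
  case 0
  show ?case using arg_cong[OF flux_0_step[of n], of "\<lambda>t. t * h 0"] by (simp add: algebra_simps)
next
  case (Suc K)
  have "(real n + 1) ^ 2 / ((real n + 3 / 2) * (real n + 1 / 2)) * (\<Sum>k\<le>Suc K. bauer k * damp (Suc n) k * h k)
     - (\<Sum>k\<le>Suc K. bauer k * damp n k * h k)
    = ((real n + 1) ^ 2 / ((real n + 3 / 2) * (real n + 1 / 2)) * (\<Sum>k\<le>K. bauer k * damp (Suc n) k * h k)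
     - (\<Sum>k\<le>K. bauer k * damp n k * h k))
     + ((real n + 1) ^ 2 / ((real n + 3 / 2) * (real n + 1 / 2)) * (bauer (Suc K) * damp (Suc n) (Suc K))
     - bauer (Suc K) * damp n (Suc K)) * h (Suc K)"
    by (simp add: distrib_left left_diff_distrib)
  also have "\<dots> = 2 / (real n + 1 / 2) * (flux n (Suc K) * h (Suc K) - (\<Sum>k<Suc K. flux n k * (h (Suc k) - h k)))"
    unfolding Suc flux_Suc_step by (simp add: algebra_simps del: times_divide_eq_left times_divide_eq_right)
  finally show ?case .
qed

text \<open>F(n) of the overview, the reciprocal of a partial Wallis product.\<close>

definition norm_factor :: "nat \<Rightarrow> real" where
  "norm_factor n = (2 * real n + 1) * central n ^ 2"

lemma norm_factor_Suc:
  "norm_factor (Suc n) * (real n + 1) ^ 2 = norm_factor n * ((real n + 3 / 2) * (real n + 1 / 2))"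
  unfolding norm_factor_def central_Suc by (simp add: divide_simps power2_eq_square) (simp add: algebra_simps)

lemma norm_factor_pos: "norm_factor n > 0"
  using central_pos[of n] by (simp add: norm_factor_def zero_less_mult_iff)

text \<open>Take \<open>K = Suc n\<close> in \<open>flux_sum\<close>: the boundary flux and the
  extra term at level \<open>n\<close> both contain \<open>damp n (Suc n) = 0\<close>. Division by
  \<open>norm_factor\<close> absorbs the coefficient.\<close>

lemma damped_sum_step:
  "(\<Sum>k\<le>Suc n. bauer k * damp (Suc n) k * h k) / norm_factor (Suc n)
   = (\<Sum>k\<le>n. bauer k * damp n k * h k) / norm_factor n
     - 2 / ((real n + 1 / 2) * norm_factor n) * (\<Sum>k\<le>n. flux n k * (h (Suc k) - h k))"
proof -
  define A B S where "A = (\<Sum>k\<le>Suc n. bauer k * damp (Suc n) k * h k)"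
    and "B = (\<Sum>k\<le>n. bauer k * damp n k * h k)"
    and "S = (\<Sum>k\<le>n. flux n k * (h (Suc k) - h k))"
  have pos: "real n + 1 / 2 > 0" "real n + 3 / 2 > 0" by linarith+
  have "flux n (Suc n) = 0" by (simp add: flux_def damp_eq_0)
  moreover have "(\<Sum>k\<le>Suc n. bauer k * damp n k * h k) = B"
    by (simp add: B_def damp_eq_0)
  ultimately have "(real n + 1) ^ 2 / ((real n + 3 / 2) * (real n + 1 / 2)) * A - B = 2 / (real n + 1 / 2) * (- S)"
    using flux_sum[where n = n and K = "Suc n" and h = h]
    by (simp add: A_def[symmetric] S_def lessThan_Suc_atMost del: sum.atMost_Suc)
  moreover have "(real n + 1) ^ 2 / ((real n + 3 / 2) * (real n + 1 / 2)) = norm_factor n / norm_factor (Suc n)"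
    using norm_factor_Suc[of n] norm_factor_pos[of "Suc n"] pos by (simp add: frac_eq_eq mult_ac)
  ultimately have *: "norm_factor n * (A / norm_factor (Suc n)) = B - 2 / (real n + 1 / 2) * S"
    by (simp add: eq_diff_eq)
  have "A / norm_factor (Suc n) = (norm_factor n * (A / norm_factor (Suc n))) / norm_factor n"
    using norm_factor_pos[of n] by simp
  thus ?thesis unfolding * A_def[symmetric] B_def[symmetric] S_def[symmetric] by (simp add: diff_divide_distrib)
qed

text \<open>A constant weight has zero differences, so the normalised sum does not change with
  \<open>n\<close>.\<close>

lemma bauer_finite: "(\<Sum>k\<le>n. bauer k * damp n k) = norm_factor n"
proof -
  have "(\<Sum>k\<le>n. bauer k * damp n k) / norm_factor n = 1"
  proof (induction n)
    case 0
    show ?case by (simp add: bauer_def norm_factor_def)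
  next
    case (Suc n)
    thus ?case using damped_sum_step[of n "\<lambda>_. 1"] by simp
  qed
  thus ?thesis using norm_factor_pos[of n] by (simp add: field_simps)
qed

section \<open>Harmonic weights in the finite identity\<close>

lemma harmonic_order_Suc: "harmonic_order r (Suc n) = harmonic_order r n + 1 / (real n + 1) ^ r"
  by (simp add: harmonic_order_def add.commute)

text \<open>The factor 8 turns the increment into
  \<open>1 / (k + 1 / 2) ^ 3 + 1 / (k + 1) ^ 3\<close>. The cube in \<open>flux\<close> cancels the
  first denominator and, over the second, raises \<open>central k\<close> to
  \<open>central (Suc k)\<close>.\<close>

lemma flux_weighted:
  "flux n k * (8 * harmonic_order 3 (2 * Suc k) - 8 * harmonic_order 3 (2 * k))
   = (-1) ^ k * (central k ^ 3 + central (Suc k) ^ 3) * (damp n k / (real n + real k + 3 / 2))"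
proof -
  have e: "2 * Suc k = Suc (Suc (2 * k))" by simp
  have h: "8 * harmonic_order 3 (2 * Suc k) - 8 * harmonic_order 3 (2 * k)
      = 1 / (real k + 1 / 2) ^ 3 + 1 / (real k + 1) ^ 3"
    unfolding e harmonic_order_Suc by (simp add: divide_simps power3_eq_cube) (simp add: algebra_simps)
  have nz: "real k + 1 / 2 \<noteq> 0" "real k + 1 \<noteq> 0" by linarith+
  define q where "q = (real k + 1 / 2) ^ 3"
  have "q \<noteq> 0" using nz by (simp add: q_def)
  have c: "central (Suc k) ^ 3 = central k ^ 3 * q / (real k + 1) ^ 3"
    by (simp add: central_Suc power_mult_distrib power_divide q_def)
  have "q * (1 / q + 1 / (real k + 1) ^ 3) = 1 + q / (real k + 1) ^ 3"
    using \<open>q \<noteq> 0\<close> by (simp add: algebra_simps)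
  moreover have ring: "s * c * d * q / e * w = s * (c * v) * (d / e)" if "q * w = v" for s c d e w v :: real
    by (simp add: that[symmetric])
  ultimately have "flux n k * (1 / q + 1 / (real k + 1) ^ 3)
     = (-1) ^ k * (central k ^ 3 * (1 + q / (real k + 1) ^ 3)) * (damp n k / (real n + real k + 3 / 2))"
    unfolding flux_def q_def[symmetric] by (intro ring)
  thus ?thesis unfolding h c q_def[symmetric] by (simp add: distrib_left)
qed

text \<open>Over a common denominator the numerator is \<open>(n - k) - (n + k + 5 / 2)\<close>,
  which is minus half the linear factor of \<open>bauer (Suc k)\<close>. Hence the Bauer terms
  reappear, with damping \<open>n + 1\<close>.\<close>

lemma damp_quotient_diff:
  "damp n (Suc k) / (real n + real (Suc k) + 3 / 2) - damp n k / (real n + real k + 3 / 2)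
     = - (4 * real (Suc k) + 1) * damp (Suc n) (Suc k) / (2 * (real n + 1) * (real n + 3 / 2))"
proof -
  define A B where "A = real n + real k + 3 / 2" and "B = real n + real k + 5 / 2"
  have nz: "A \<noteq> 0" "B \<noteq> 0" "real n + 1 \<noteq> 0" "real n + 3 / 2 \<noteq> 0" unfolding A_def B_def by linarith+
  have B: "real n + real (Suc k) + 3 / 2 = B" by (simp add: B_def)
  have "damp n (Suc k) / B - damp n k / A = damp n k * ((real n - real k) - B) / (A * B)"
    unfolding damp_Suc A_def[symmetric] using nz by (simp add: field_simps)
  also have "(real n - real k) - B = - (4 * real (Suc k) + 1) / 2"
    by (simp add: B_def field_simps)
  also have "damp n k * (- (4 * real (Suc k) + 1) / 2) / (A * B)
      = - (4 * real (Suc k) + 1) * damp (Suc n) (Suc k) / (2 * (real n + 1) * (real n + 3 / 2))"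
    unfolding damp_Suc_Suc A_def[symmetric] B_def[symmetric] using nz by (simp add: divide_simps)
  finally show ?thesis unfolding B A_def .
qed

text \<open>Summation by parts: each \<open>central (Suc k) ^ 3\<close> occurs in two neighbouring
  terms with opposite signs and meets a difference of quotients. The first quotient and the last
  term remain; the \<open>- 1\<close> removes the Bauer term at 0.\<close>

lemma weighted_sum_partial:
  "(\<Sum>k\<le>K. (-1) ^ k * (central k ^ 3 + central (Suc k) ^ 3) * (damp n k / (real n + real k + 3 / 2)))
   = 1 / (real n + 3 / 2)
     - ((\<Sum>k\<le>K. bauer k * damp (Suc n) k) - 1) / (2 * (real n + 1) * (real n + 3 / 2))
     + (-1) ^ K * central (Suc K) ^ 3 * (damp n K / (real n + real K + 3 / 2))"
proof (induction K)
  case 0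
  show ?case by (simp add: bauer_def distrib_right add_divide_distrib)
next
  case (Suc K)
  define z where "z = (-1) ^ K * central (Suc K) ^ 3"
  define w w' where "w = damp n K / (real n + real K + 3 / 2)"
    and "w' = damp n (Suc K) / (real n + real (Suc K) + 3 / 2)"
  define d where "d = 2 * (real n + 1) * (real n + 3 / 2)"
  define e where "e = 4 * real (Suc K) + 1"
  have "bauer (Suc K) = - (z * e)"
    by (simp add: bauer_def z_def e_def)
  hence b: "bauer (Suc K) * damp (Suc n) (Suc K) / d = z * (w' - w)"
    unfolding w_def w'_def damp_quotient_diff d_def[symmetric] e_def[symmetric] by simp
  show ?case
    unfolding sum.atMost_Suc[of _ K] Suc w_def[symmetric] w'_def[symmetric] d_def[symmetric]
    using b by (simp add: z_def[symmetric] add_divide_distrib diff_divide_distrib) (simp add: z_def algebra_simps)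
qed

lemma weighted_sum:
  "(\<Sum>k\<le>n. (-1) ^ k * (central k ^ 3 + central (Suc k) ^ 3) * (damp n k / (real n + real k + 3 / 2)))
   = (2 * real n + 3 - norm_factor (Suc n)) / (2 * (real n + 1) * (real n + 3 / 2))"
proof -
  have nz: "real n + 1 \<noteq> 0" "real n + 3 / 2 \<noteq> 0" by linarith+
  have "(\<Sum>k\<le>n. (-1) ^ k * (central k ^ 3 + central (Suc k) ^ 3) * (damp n k / (real n + real k + 3 / 2)))
     = 1 / (real n + 3 / 2) - (norm_factor (Suc n) - 1) / (2 * (real n + 1) * (real n + 3 / 2))"
    \<comment> \<open>With \<open>K = Suc n\<close> the Bauer sum is complete for damping
      \<open>n + 1\<close>; the surplus term and the boundary term contain
      \<open>damp n (Suc n) = 0\<close>.\<close>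
    using weighted_sum_partial[of n "Suc n"] by (simp only: bauer_finite) (simp add: damp_eq_0)
  also have "\<dots> = (2 * real n + 3 - norm_factor (Suc n)) / (2 * (real n + 1) * (real n + 3 / 2))"
    using nz by (simp add: divide_simps)
  finally show ?thesis .
qed

text \<open>After normalisation, \<open>damped_sum_step\<close> and \<open>weighted_sum\<close> give
  the increment \<open>1 / a ^ 3 - 1 / (a ^ 3 * c ^ 2)\<close>, where \<open>a = n + 1\<close> and
  \<open>c = central (Suc n)\<close>.\<close>

lemma bauer_harmonic_finite:
  "(\<Sum>k\<le>n. bauer k * damp n k * (8 * harmonic_order 3 (2 * k)))
     = norm_factor n * (harmonic_order 3 n - (\<Sum>m<n. 1 / (real (Suc m) ^ 3 * central (Suc m) ^ 2)))"
proof -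
  let ?U = "\<lambda>n. (\<Sum>k\<le>n. bauer k * damp n k * (8 * harmonic_order 3 (2 * k)))"
  have "?U n / norm_factor n = harmonic_order 3 n - (\<Sum>m<n. 1 / (real (Suc m) ^ 3 * central (Suc m) ^ 2))"
  proof (induction n)
    case 0
    show ?case by (simp add: harmonic_order_def)
  next
    case (Suc n)
    define a where "a = real n + 1"
    define F c where "F = norm_factor n" and "c = central (Suc n)"
    have nz: "a \<noteq> 0" "real n + 1 / 2 \<noteq> 0" "real n + 3 / 2 \<noteq> 0" "F \<noteq> 0" "c \<noteq> 0"
      using norm_factor_pos[of n] central_pos[of "Suc n"] unfolding F_def c_def a_def by linarith+
    have F1: "norm_factor (Suc n) = 2 * (real n + 3 / 2) * c ^ 2"
      by (simp add: norm_factor_def c_def)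
    have "(real n + 3 / 2) * (F * (real n + 1 / 2)) = (real n + 3 / 2) * (2 * c ^ 2 * a ^ 2)"
      using norm_factor_Suc[of n] unfolding F1 F_def[symmetric] a_def[symmetric] by (simp only: mult_ac)
    hence F2: "F * (real n + 1 / 2) = 2 * c ^ 2 * a ^ 2"
      unfolding mult_left_cancel[OF nz(3)] .
    have "?U (Suc n) / norm_factor (Suc n) = ?U n / norm_factor n
       - 2 / ((real n + 1 / 2) * F) * ((2 * real n + 3 - 2 * (real n + 3 / 2) * c ^ 2) / (2 * a * (real n + 3 / 2)))"
      using damped_sum_step[of n "\<lambda>k. 8 * harmonic_order 3 (2 * k)"]
      unfolding flux_weighted weighted_sum F1 F_def a_def .
    also have "2 / ((real n + 1 / 2) * F) * ((2 * real n + 3 - 2 * (real n + 3 / 2) * c ^ 2) / (2 * a * (real n + 3 / 2)))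
      = 2 / (2 * c ^ 2 * a ^ 2) * ((1 - c ^ 2) / a)"
    proof -
      have k1: "2 * real n + 3 - 2 * (real n + 3 / 2) * c ^ 2 = (1 - c ^ 2) * (2 * (real n + 3 / 2))"
        by (simp add: algebra_simps)
      have k2: "(real n + 1 / 2) * F = 2 * c ^ 2 * a ^ 2"
        using F2 by (simp only: mult.commute)
      have k3: "x * (2 * b) / (2 * a * b) = x / a" if "b \<noteq> 0" for x b :: real
        using that by simp
      show ?thesis unfolding k1 k2 k3[OF nz(3)] ..
    qed
    also have "\<dots> = 1 / (a ^ 3 * c ^ 2) - 1 / a ^ 3"
      using nz by (simp add: field_simps power2_eq_square power3_eq_cube)
    finally show ?case
      by (simp add: Suc harmonic_order_Suc a_def c_def add.commute)
  qed
  thus ?thesis using norm_factor_pos[of n] by (simp add: field_simps)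
qed

subsection \<open>Removing the damping\<close>

lemma damp_nonneg: "damp n k \<ge> 0"
proof (cases "k \<le> n")
  case True
  thus ?thesis by (auto simp: damp_def intro!: prod_nonneg)
qed (simp add: damp_eq_0)

lemma damp_decreasing: "damp n (Suc k) \<le> damp n k"
proof (cases "k \<le> n")
  case True
  have "(real n - real k) / (real n + real k + 3 / 2) \<le> 1" by simp
  from mult_left_mono[OF this damp_nonneg[of n k]] show ?thesis
    by (simp add: damp_Suc)
qed (simp add: damp_eq_0)

lemma damp_le_1: "damp n k \<le> 1"
  by (induction k) (auto intro: order_trans[OF damp_decreasing])

lemma damp_tendsto: "(\<lambda>n. damp n k) \<longlonglongrightarrow> 1"
proof -
  have "(\<lambda>n. \<Prod>j<k. (real n - real j) / (real n + 3 / 2 + real j)) \<longlonglongrightarrow> (\<Prod>j<k. 1)"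
    by (intro tendsto_prod) real_asymp
  thus ?thesis by (simp add: damp_def)
qed

text \<open>The alternating tails of the damped series are bounded uniformly in \<open>n\<close> by their first terms.\<close>
lemma damped_alternating_tendsto:
  fixes d :: "nat \<Rightarrow> real"
  assumes zero: "d \<longlonglongrightarrow> 0" and nonneg: "\<And>k. d k \<ge> 0" and dec: "\<And>k. d (Suc k) \<le> d k"
  shows "(\<lambda>n. \<Sum>k\<le>n. (-1) ^ k * d k * damp n k) \<longlonglongrightarrow> (\<Sum>k. (-1) ^ k * d k)"
proof (rule LIMSEQ_I)
  fix e :: real assume e: "e > 0"
  \<comment> \<open>After an even number of terms the partial sum lies below the limit, and the next
    one lies above it.\<close>
  have tail: "\<bar>(\<Sum>k. (-1) ^ k * a k) - (\<Sum>k<2 * m. (-1) ^ k * a k)\<bar> \<le> a (2 * m)"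
    if "a \<longlonglongrightarrow> 0" "\<And>k. a k \<ge> 0" "\<And>k. a (Suc k) \<le> a k" for a :: "nat \<Rightarrow> real" and m
    using summable_Leibniz'(2)[OF that, of m] summable_Leibniz'(4)[OF that, of m] by simp
  have damp_d: "d k * damp n k \<le> d k" for n k
    using mult_left_mono[OF damp_le_1[of n k] nonneg[of k]] by simp
  from LIMSEQ_D[OF zero, of "e / 4"] e obtain N where N: "\<And>k. k \<ge> N \<Longrightarrow> norm (d k) < e / 4"
    by auto
  define m where "m = N"
  have dm: "d (2 * m) < e / 4" using N[of "2 * m"] by (simp add: m_def)
  \<comment> \<open>The head converges termwise; head and two tails together cost less than
    \<open>3 * e / 4\<close>.\<close>
  have "(\<lambda>n. \<Sum>k<2 * m. (-1) ^ k * (d k * damp n k)) \<longlonglongrightarrow> (\<Sum>k<2 * m. (-1) ^ k * (d k * 1))"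
    by (intro tendsto_intros damp_tendsto)
  from LIMSEQ_D[OF this, of "e / 4"] e obtain M where M:
    "\<And>n. n \<ge> M \<Longrightarrow> \<bar>(\<Sum>k<2 * m. (-1) ^ k * (d k * damp n k)) - (\<Sum>k<2 * m. (-1) ^ k * d k)\<bar> < e / 4"
    by auto
  have "norm ((\<Sum>k\<le>n. (-1) ^ k * d k * damp n k) - (\<Sum>k. (-1) ^ k * d k)) < e" if "n \<ge> M" for n
  proof -
    let ?a = "\<lambda>k. d k * damp n k"
    have "(\<Sum>k. (-1) ^ k * ?a k) = (\<Sum>k\<le>n. (-1) ^ k * ?a k)"
      by (intro suminf_finite) (auto simp: damp_eq_0)
    moreover have "?a \<longlonglongrightarrow> 0"
      by (rule tendsto_sandwich[OF _ _ tendsto_const zero])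
         (simp_all add: nonneg damp_nonneg damp_d)
    moreover have "?a (Suc k) \<le> ?a k" for k
      by (intro mult_mono dec damp_decreasing nonneg damp_nonneg)
    ultimately have "\<bar>(\<Sum>k\<le>n. (-1) ^ k * ?a k) - (\<Sum>k<2 * m. (-1) ^ k * ?a k)\<bar> \<le> ?a (2 * m)"
      using tail[of ?a m] by (simp add: nonneg damp_nonneg)
    moreover have "?a (2 * m) \<le> d (2 * m)" by (rule damp_d)
    ultimately show ?thesis
      using tail[OF zero nonneg dec, of m] M[OF that] dm unfolding mult.assoc real_norm_def by linarith
  qed
  thus "\<exists>no. \<forall>n\<ge>no. norm ((\<Sum>k\<le>n. (-1) ^ k * d k * damp n k) - (\<Sum>k. (-1) ^ k * d k)) < e"
    by blast
qed

section \<open>Wallis limit and behaviour of the coefficients\<close>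

lemma norm_factor_wallis: "norm_factor n = inverse (\<Prod>k=1..n. (4 * real k ^ 2) / (4 * real k ^ 2 - 1))"
proof (induction n)
  case 0
  show ?case by (simp add: norm_factor_def)
next
  case (Suc n)
  have "norm_factor (Suc n) = norm_factor n * ((real n + 3 / 2) * (real n + 1 / 2)) / (real n + 1) ^ 2"
    using norm_factor_Suc[of n] by (simp add: eq_divide_eq)
  also have "\<dots> = norm_factor n * ((4 * real (Suc n) ^ 2 - 1) / (4 * real (Suc n) ^ 2))"
    by (simp add: field_simps power2_eq_square)
  finally show ?case unfolding Suc prod.nat_ivl_Suc'[of 1 n, simplified] by (simp add: field_simps)
qed

lemma norm_factor_tendsto: "norm_factor \<longlonglongrightarrow> 2 / pi"
proof -
  have "(\<lambda>n. inverse (\<Prod>k=1..n. (4 * real k ^ 2) / (4 * real k ^ 2 - 1))) \<longlonglongrightarrow> inverse (pi / 2)"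
    by (intro tendsto_inverse wallis) simp
  thus ?thesis unfolding norm_factor_wallis[symmetric] by simp
qed

text \<open>The square is \<open>norm_factor n / (2 * n + 1)\<close>, a convergent sequence over an
  unbounded one.\<close>

lemma central_tendsto: "central \<longlonglongrightarrow> 0"
proof -
  have "(\<lambda>n. norm_factor n * (1 / (2 * real n + 1))) \<longlonglongrightarrow> 2 / pi * 0"
    by (intro tendsto_mult norm_factor_tendsto) real_asymp
  moreover have "norm_factor n * (1 / (2 * real n + 1)) = central n ^ 2" for n
    by (simp add: norm_factor_def)
  ultimately have "(\<lambda>n. sqrt (central n ^ 2)) \<longlonglongrightarrow> sqrt 0"
    by (intro tendsto_real_sqrt) simp
  thus ?thesis using central_pos by (simp add: less_imp_le)
qed

definition bauer_abs :: "nat \<Rightarrow> real" where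
  "bauer_abs k = (4 * real k + 1) * central k ^ 3"

lemma bauer_eq: "bauer k = (-1) ^ k * bauer_abs k"
  by (simp add: bauer_def bauer_abs_def)

lemma bauer_abs_nonneg: "bauer_abs k \<ge> 0"
  using central_pos[of k] by (simp add: bauer_abs_def)

lemma bauer_abs_tendsto: "bauer_abs \<longlonglongrightarrow> 0"
proof -
  have "(\<lambda>k. (4 * real k + 1) / (2 * real k + 1) * (norm_factor k * central k)) \<longlonglongrightarrow> 2 * (2 / pi * 0)"
    by (intro tendsto_mult norm_factor_tendsto central_tendsto) real_asymp
  moreover have "(4 * real k + 1) / (2 * real k + 1) * (norm_factor k * central k) = bauer_abs k" for k
    by (simp add: bauer_abs_def norm_factor_def power2_eq_square power3_eq_cube)
  ultimately show ?thesis by simp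
qed

lemma bauer_abs_decreasing: "bauer_abs (Suc k) \<le> bauer_abs k"
proof -
  \<comment> \<open>After expansion the inequality holds coefficient by coefficient in
    \<open>k\<close>.\<close>
  have "(4 * real k + 5) * (real k + 1 / 2) ^ 3 \<le> (4 * real k + 1) * (real k + 1) ^ 3"
    by (simp add: power3_eq_cube field_simps)
  hence "(4 * real k + 5) * (real k + 1 / 2) ^ 3 / (real k + 1) ^ 3 \<le> 4 * real k + 1"
    by (simp add: divide_le_eq)
  from mult_left_mono[OF this, of "central k ^ 3"] central_pos[of k] show ?thesis
    by (simp add: bauer_abs_def central_Suc power_mult_distrib power_divide mult_ac add_ac)
qed

lemma summable_zeta3: "summable (\<lambda>k. 1 / real (Suc k) ^ 3)"
  using inverse_power_summable[of 3, where ?'a = real] summable_Suc_iff[of "\<lambda>k. inverse (real k ^ 3)"]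
  by (simp add: field_simps)

lemma harmonic_order_3_eq: "harmonic_order 3 n = (\<Sum>k<n. 1 / real (Suc k) ^ 3)"
  by (induction n) (simp_all add: harmonic_order_Suc harmonic_order_def[of _ 0] add.commute)

lemma harmonic_order_3_tendsto: "harmonic_order 3 \<longlonglongrightarrow> zeta3"
  using summable_LIMSEQ[OF summable_zeta3] by (simp add: harmonic_order_3_eq[abs_def] zeta3_def)

lemma harmonic_order_3_tendsto_double: "(\<lambda>k. harmonic_order 3 (2 * k)) \<longlonglongrightarrow> zeta3"
  by (rule LIMSEQ_subseq_LIMSEQ[OF harmonic_order_3_tendsto, of "\<lambda>k. 2 * k", unfolded o_def])
     (simp add: strict_mono_def)

lemma harmonic_order_3_le: "harmonic_order 3 n \<le> zeta3"
  unfolding harmonic_order_3_eq zeta3_def by (rule sum_le_suminf[OF summable_zeta3]) auto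

section \<open>Passage to the infinite series\<close>

lemma bauer_sums: "bauer sums (2 / pi)"
proof -
  have "(\<lambda>n. \<Sum>k\<le>n. (-1) ^ k * bauer_abs k * damp n k) = norm_factor"
    by (simp add: bauer_finite[symmetric] bauer_eq fun_eq_iff)
  hence "(\<Sum>k. (-1) ^ k * bauer_abs k) = 2 / pi"
    using LIMSEQ_unique[OF damped_alternating_tendsto[OF bauer_abs_tendsto bauer_abs_nonneg bauer_abs_decreasing]]
      norm_factor_tendsto by simp
  thus ?thesis
    using summable_sums[OF summable_Leibniz'(1)[OF bauer_abs_tendsto bauer_abs_nonneg bauer_abs_decreasing]]
    by (simp add: bauer_eq[abs_def])
qed

text \<open>The limit theorem wants decreasing coefficients, but the harmonic numbers increase. It
  is therefore applied with the weight \<open>zeta3 - harmonic_order 3 (2 * k)\<close>, which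
  decreases to 0, and \<open>bauer_sums\<close> supplies the part with constant weight
  \<open>zeta3\<close>.\<close>

lemma bauer_harmonic_sums:
  assumes S: "(\<lambda>m. 1 / (real (Suc m) ^ 3 * central (Suc m) ^ 2)) sums S"
  shows "(\<lambda>k. bauer k * (8 * harmonic_order 3 (2 * k))) sums (2 / pi * (zeta3 - S))"
proof -
  define d where "d k = bauer_abs k * (zeta3 - harmonic_order 3 (2 * k))" for k
  have "d \<longlonglongrightarrow> 0 * (zeta3 - zeta3)"
    unfolding d_def by (intro tendsto_intros bauer_abs_tendsto harmonic_order_3_tendsto_double)
  hence zero: "d \<longlonglongrightarrow> 0" by simp
  have nonneg: "d k \<ge> 0" for k
    unfolding d_def by (intro mult_nonneg_nonneg bauer_abs_nonneg) (simp add: harmonic_order_3_le)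
  have "harmonic_order 3 (2 * k) \<le> harmonic_order 3 (2 * Suc k)" for k
    unfolding harmonic_order_3_eq by (intro sum_mono2) auto
  hence dec: "d (Suc k) \<le> d k" for k
    unfolding d_def by (intro mult_mono bauer_abs_decreasing bauer_abs_nonneg) (auto simp: harmonic_order_3_le)
  have fin: "(\<Sum>k\<le>n. (-1) ^ k * d k * damp n k) = zeta3 * norm_factor n
      - norm_factor n * (harmonic_order 3 n - (\<Sum>m<n. 1 / (real (Suc m) ^ 3 * central (Suc m) ^ 2))) / 8" for n
  proof -
    have "(-1) ^ k * d k * damp n k
        = zeta3 * (bauer k * damp n k) - bauer k * damp n k * (8 * harmonic_order 3 (2 * k)) / 8" for k
      by (simp add: d_def bauer_eq algebra_simps)
    thus ?thesis
      by (simp only: sum_subtractf sum_distrib_left[symmetric] sum_divide_distrib[symmetric]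
          bauer_finite bauer_harmonic_finite)
  qed
  have "(\<lambda>n. zeta3 * norm_factor n
      - norm_factor n * (harmonic_order 3 n - (\<Sum>m<n. 1 / (real (Suc m) ^ 3 * central (Suc m) ^ 2))) / 8)
     \<longlonglongrightarrow> zeta3 * (2 / pi) - 2 / pi * (zeta3 - S) / 8"
    by (intro tendsto_intros norm_factor_tendsto harmonic_order_3_tendsto S[unfolded sums_def]) simp
  from LIMSEQ_unique[OF damped_alternating_tendsto[OF zero nonneg dec, unfolded fin] this]
  have "(\<lambda>k. (-1) ^ k * d k) sums (zeta3 * (2 / pi) - 2 / pi * (zeta3 - S) / 8)"
    using summable_sums[OF summable_Leibniz'(1)[OF zero nonneg dec]] by simp
  hence "(\<lambda>k. 8 * (zeta3 * bauer k - (-1) ^ k * d k)) sums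
      (8 * (zeta3 * (2 / pi) - (zeta3 * (2 / pi) - 2 / pi * (zeta3 - S) / 8)))"
    by (intro sums_mult sums_diff bauer_sums)
  also have "(\<lambda>k. 8 * (zeta3 * bauer k - (-1) ^ k * d k)) = (\<lambda>k. bauer k * (8 * harmonic_order 3 (2 * k)))"
    by (simp add: d_def bauer_eq algebra_simps)
  also have "8 * (zeta3 * (2 / pi) - (zeta3 * (2 / pi) - 2 / pi * (zeta3 - S) / 8)) = 2 / pi * (zeta3 - S)"
    by (simp add: field_simps)
  finally show ?thesis .
qed

subsection \<open>The series of reciprocal squared central binomials\<close>

lemma sin_pos_half: "0 < x \<Longrightarrow> x \<le> pi / 2 \<Longrightarrow> sin x > 0" for x :: real
  by (intro sin_gt_zero) (use pi_gt_zero in linarith)+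

lemma sin_power_deriv:
  "((\<lambda>x. sin x ^ Suc k) has_real_derivative (real k + 1) * (cos x * sin x ^ k)) (at x within S)"
  using DERIV_power_Suc[OF DERIV_subset[OF DERIV_sin, of S x], of k] by (simp add: add.commute)

text \<open>Jordan's inequality: the concave sine lies above its chord on
  \<open>{0..pi / 2}\<close>.\<close>

lemma le_pi_half_sin:
  fixes x :: real
  assumes "0 \<le> x" "x \<le> pi / 2"
  shows "x \<le> pi / 2 * sin x"
proof -
  have conv: "convex_on {0..pi / 2} (\<lambda>x. - sin x)"
  proof (rule f''_ge0_imp_convex)
    show "((\<lambda>x. - sin x) has_real_derivative - cos x) (at x)" for x :: real
      by (auto intro!: derivative_eq_intros)
    show "((\<lambda>x. - cos x) has_real_derivative sin x) (at x)" for x :: real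
      by (auto intro!: derivative_eq_intros)
    show "0 \<le> sin x" if "x \<in> {0..pi / 2}" for x
      using that by (intro sin_ge_zero) auto
  qed auto
  have "- sin ((1 - 2 * x / pi) *\<^sub>R 0 + (2 * x / pi) *\<^sub>R (pi / 2))
      \<le> (1 - 2 * x / pi) * - sin 0 + (2 * x / pi) * - sin (pi / 2)"
    using assms by (intro convex_onD[OF conv]) (auto simp: field_simps)
  thus ?thesis by (simp add: field_simps)
qed

text \<open>The remainder of the power series of \<open>arcsin\<^sup>2\<close> at \<open>sin x\<close>, and its derivative. The second
  derivative telescopes to a single power of \<open>sin x\<close>.\<close>
definition arcsin_rem :: "nat \<Rightarrow> real \<Rightarrow> real" where
  "arcsin_rem M x = x ^ 2 - (\<Sum>m<M. sin x ^ (2 * m + 2) / (2 * real (Suc m) ^ 2 * central (Suc m)))"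

definition arcsin_rem' :: "nat \<Rightarrow> real \<Rightarrow> real" where
  "arcsin_rem' M x = 2 * x - (\<Sum>m<M. sin x ^ (2 * m + 1) * cos x / (real (Suc m) * central (Suc m)))"

lemma arcsin_rem_0 [simp]: "arcsin_rem M 0 = 0" "arcsin_rem' M 0 = 0"
  by (simp_all add: arcsin_rem_def arcsin_rem'_def)

lemma arcsin_rem_deriv: "(arcsin_rem M has_real_derivative arcsin_rem' M x) (at x)"
proof -
  have "((\<lambda>x. sin x ^ (2 * m + 2) / (2 * real (Suc m) ^ 2 * central (Suc m))) has_real_derivative
      sin x ^ (2 * m + 1) * cos x / (real (Suc m) * central (Suc m))) (at x)" for m
  proof -
    have "((\<lambda>x. sin x ^ (2 * m + 2) / (2 * real (Suc m) ^ 2 * central (Suc m))) has_real_derivative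
        (real (2 * m + 2) * (cos x * sin x ^ (2 * m + 1))) / (2 * real (Suc m) ^ 2 * central (Suc m))) (at x)"
      using DERIV_cdivide[OF sin_power_deriv[of "2 * m + 1" x UNIV]] by (simp add: add_ac)
    also have "real (2 * m + 2) * (cos x * sin x ^ (2 * m + 1)) / (2 * real (Suc m) ^ 2 * central (Suc m))
       = sin x ^ (2 * m + 1) * cos x / (real (Suc m) * central (Suc m))"
    proof -
      have "real (2 * m + 2) = 2 * real (Suc m)" by simp
      thus ?thesis by (simp add: power2_eq_square mult_ac del: of_nat_Suc)
    qed
    finally show ?thesis .
  qed
  thus ?thesis unfolding arcsin_rem_def[abs_def] arcsin_rem'_def
    by (intro DERIV_diff DERIV_sum) (auto intro!: derivative_eq_intros)
qed

lemma arcsin_rem'_deriv: "(arcsin_rem' M has_real_derivative 2 / central M * sin x ^ (2 * M)) (at x)"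
proof (induction M)
  case 0
  show ?case by (auto simp: arcsin_rem'_def[abs_def] intro!: derivative_eq_intros)
next
  case (Suc M)
  have "((\<lambda>x. sin x ^ (2 * M + 1) * cos x / (real (Suc M) * central (Suc M))) has_real_derivative
      (real (2 * M + 1) * sin x ^ (2 * M) * cos x ^ 2 - sin x ^ (2 * M + 2)) / (real (Suc M) * central (Suc M))) (at x)"
  proof (intro DERIV_cdivide)
    have "((\<lambda>x. sin x ^ Suc (2 * M) * cos x) has_real_derivative
        (real (2 * M) + 1) * (cos x * sin x ^ (2 * M)) * cos x + - sin x * sin x ^ Suc (2 * M)) (at x)"
      by (intro DERIV_mult sin_power_deriv DERIV_cos)
    thus "((\<lambda>x. sin x ^ (2 * M + 1) * cos x) has_real_derivative
        real (2 * M + 1) * sin x ^ (2 * M) * cos x ^ 2 - sin x ^ (2 * M + 2)) (at x)"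
      by (simp add: power2_eq_square mult_ac add_ac)
  qed
  from DERIV_diff[OF Suc this] have
    "(arcsin_rem' (Suc M) has_real_derivative 2 / central M * sin x ^ (2 * M) -
      (real (2 * M + 1) * sin x ^ (2 * M) * cos x ^ 2 - sin x ^ (2 * M + 2)) / (real (Suc M) * central (Suc M))) (at x)"
    by (simp add: arcsin_rem'_def[abs_def] algebra_simps)
  also have "real (2 * M + 1) * sin x ^ (2 * M) * cos x ^ 2 - sin x ^ (2 * M + 2)
      = sin x ^ (2 * M) * (2 * real M + 1) - sin x ^ (2 * M + 2) * (2 * real (Suc M))"
    unfolding power_add[of _ "2 * M" 2] cos_squared_eq by (simp add: algebra_simps)
  \<comment> \<open>In this form the part with \<open>sin x ^ (2 * M)\<close> becomes
    \<open>2 / central M * sin x ^ (2 * M)\<close> and cancels the derivative from the induction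
    hypothesis.\<close>
  also have "real (Suc M) * central (Suc M) = (2 * real M + 1) * (central M / 2)"
    by (simp add: central_Suc field_simps)
  also have "2 / central M * sin x ^ (2 * M) - (sin x ^ (2 * M) * (2 * real M + 1) - sin x ^ (2 * M + 2) * (2 * real (Suc M)))
      / ((2 * real M + 1) * (central M / 2)) = 2 / central (Suc M) * sin x ^ (2 * Suc M)"
  proof -
    have "central M > 0" "2 * real M + 1 > 0" by (auto simp: central_pos)
    thus ?thesis by (simp add: central_Suc divide_simps) (simp add: algebra_simps)
  qed
  finally show ?case .
qed

lemma arcsin_rem'_nonneg:
  assumes "0 \<le> x" "x \<le> pi / 2"
  shows "arcsin_rem' M x \<ge> 0"
proof -
  have "arcsin_rem' M 0 \<le> arcsin_rem' M x"
  proof (rule DERIV_nonneg_imp_nondecreasing[OF assms(1)])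
    show "\<exists>y. (arcsin_rem' M has_real_derivative y) (at t) \<and> 0 \<le> y" for t
      using arcsin_rem'_deriv[of M t] central_pos[of M] by (intro exI[of _ "2 / central M * sin t ^ (2 * M)"]) simp
  qed
  thus ?thesis by simp
qed

lemma arcsin_rem_nonneg:
  assumes "0 \<le> x" "x \<le> pi / 2"
  shows "arcsin_rem M x \<ge> 0"
proof -
  have "arcsin_rem M 0 \<le> arcsin_rem M x"
  proof (rule DERIV_nonneg_imp_nondecreasing[OF assms(1)])
    fix t assume "0 \<le> t" "t \<le> x"
    thus "\<exists>y. (arcsin_rem M has_real_derivative y) (at t) \<and> 0 \<le> y"
      using assms by (intro exI[of _ "arcsin_rem' M t"] conjI arcsin_rem_deriv arcsin_rem'_nonneg) auto
  qed
  thus ?thesis by simp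
qed

text \<open>The difference of the two sides vanishes at 0 and has derivative \<open>x\<close> times
  the nonnegative second derivative. This bounds the remainder by its derivative, whose integral is
  explicit.\<close>

lemma arcsin_rem_le:
  assumes "0 \<le> x" "x \<le> pi / 2"
  shows "arcsin_rem M x \<le> x * arcsin_rem' M x"
proof -
  have "0 * arcsin_rem' M 0 - arcsin_rem M 0 \<le> x * arcsin_rem' M x - arcsin_rem M x"
  proof (rule DERIV_nonneg_imp_nondecreasing[OF assms(1)])
    fix t assume t: "0 \<le> t" "t \<le> x"
    have "((\<lambda>x. x * arcsin_rem' M x - arcsin_rem M x) has_real_derivative t * (2 / central M * sin t ^ (2 * M))) (at t)"
      by (rule derivative_eq_intros arcsin_rem_deriv arcsin_rem'_deriv refl)+ simp
    moreover have "0 \<le> t * (2 / central M * sin t ^ (2 * M))"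
      using t central_pos[of M] by simp
    ultimately show "\<exists>y. ((\<lambda>x. x * arcsin_rem' M x - arcsin_rem M x) has_real_derivative y) (at t) \<and> 0 \<le> y"
      by blast
  qed
  thus ?thesis by simp
qed

text \<open>By Taylor's formula the remainder is the integral of \<open>pi / 2 - t\<close> times its
  second derivative. Jordan's inequality replaces \<open>pi / 2 - t\<close> by
  \<open>pi / 2 * cos t\<close>, and the product with \<open>sin t ^ (2 * M)\<close> then has an
  elementary antiderivative.\<close>

lemma arcsin_rem_pi_half_le: "arcsin_rem M (pi / 2) \<le> pi * central M / norm_factor M"
proof -
  define c where "c = pi / (central M * (2 * real M + 1))"
  \<comment> \<open>The Taylor argument without integrals: \<open>?p\<close> is 0 at 0 and
    nonincreasing, and at \<open>pi / 2\<close> it is the remainder minus \<open>c\<close>.\<close>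
  let ?p = "\<lambda>x. arcsin_rem M x + (pi / 2 - x) * arcsin_rem' M x - c * sin x ^ (2 * M + 1)"
  have "?p (pi / 2) \<le> ?p 0"
  proof (rule DERIV_nonpos_imp_nonincreasing[where f = ?p and a = 0 and b = "pi / 2"])
    fix t assume t: "0 \<le> t" "t \<le> pi / 2"
    let ?D = "(2 / central M * sin t ^ (2 * M)) * ((pi / 2 - t) - pi / 2 * cos t)"
    have s: "((\<lambda>x. c * sin x ^ (2 * M + 1)) has_real_derivative c * (real (2 * M + 1) * (cos t * sin t ^ (2 * M)))) (at t)"
      using DERIV_cmult[OF sin_power_deriv[of "2 * M" t UNIV]] by (simp add: add_ac)
    have "(?p has_real_derivative (arcsin_rem' M t + ((0 - 1) * arcsin_rem' M t + 2 / central M * sin t ^ (2 * M) * (pi / 2 - t))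
        - c * (real (2 * M + 1) * (cos t * sin t ^ (2 * M))))) (at t)"
      by (intro DERIV_diff DERIV_add DERIV_mult DERIV_const DERIV_ident arcsin_rem_deriv arcsin_rem'_deriv s)
    also have "c * (real (2 * M + 1) * (cos t * sin t ^ (2 * M))) = 2 / central M * sin t ^ (2 * M) * (pi / 2 * cos t)"
    proof -
      have "2 * real M + 1 \<noteq> 0" by linarith
      thus ?thesis using central_pos[of M] by (simp add: c_def add_ac)
    qed
    also have "arcsin_rem' M t + ((0 - 1) * arcsin_rem' M t + 2 / central M * sin t ^ (2 * M) * (pi / 2 - t))
        - 2 / central M * sin t ^ (2 * M) * (pi / 2 * cos t) = ?D"
      by (simp only: right_diff_distrib) simp
    finally have "(?p has_real_derivative ?D) (at t)" .
    moreover have "pi / 2 - t \<le> pi / 2 * cos t"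
      using le_pi_half_sin[of "pi / 2 - t"] t by (simp add: sin_diff)
    hence "?D \<le> 0"
      using mult_nonneg_nonpos[of "2 / central M * sin t ^ (2 * M)" "(pi / 2 - t) - pi / 2 * cos t"] central_pos[of M]
      by simp
    ultimately show "\<exists>y. (?p has_real_derivative y) (at t) \<and> y \<le> 0" by blast
  qed simp
  hence "arcsin_rem M (pi / 2) \<le> c" by simp
  also have "c = pi * central M / norm_factor M"
    using central_pos[of M] by (simp add: c_def norm_factor_def power2_eq_square mult_ac)
  finally show ?thesis .
qed

lemma sin_odd_power_integral:
  "((\<lambda>x. sin x ^ (2 * m + 1)) has_integral 1 / (2 * real (Suc m) * central (Suc m))) {0..pi / 2}"
proof (induction m)
  case 0
  have "(sin has_integral (- cos (pi / 2) - - cos 0)) {0..pi / 2}"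
    by (intro fundamental_theorem_of_calculus)
       (auto intro!: derivative_eq_intros simp flip: has_real_derivative_iff_has_vector_derivative)
  thus ?case by (simp add: central_Suc)
next
  case (Suc m)
  \<comment> \<open>The antiderivative \<open>- cos x * sin x ^ (2 * m + 2)\<close> is 0 at both
    endpoints, which gives the usual reduction formula.\<close>
  have "((\<lambda>x. (2 * real m + 3) * sin x ^ (2 * m + 3) - (2 * real m + 2) * sin x ^ (2 * m + 1)) has_integral
      (- cos (pi / 2) * sin (pi / 2) ^ (2 * m + 2) - (- cos 0 * sin 0 ^ (2 * m + 2)))) {0..pi / 2}"
  proof (intro fundamental_theorem_of_calculus)
    fix x :: real
    have "((\<lambda>x. - cos x * sin x ^ (2 * m + 2)) has_real_derivative
       sin x * sin x ^ (2 * m + 2) + (real (2 * m + 2) * (cos x * sin x ^ (2 * m + 1))) * - cos x) (at x within {0..pi / 2})"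
      using DERIV_mult[OF DERIV_minus[OF has_field_derivative_at_within[OF DERIV_cos]]
          sin_power_deriv[of "2 * m + 1" x "{0..pi / 2}"]]
      by (simp add: add_ac)
    also have "sin x * sin x ^ (2 * m + 2) + (real (2 * m + 2) * (cos x * sin x ^ (2 * m + 1))) * - cos x
      = sin x ^ (2 * m + 3) - (2 * real m + 2) * sin x ^ (2 * m + 1) * cos x ^ 2"
      by (simp add: power2_eq_square eval_nat_numeral algebra_simps)
    also have "\<dots> = (2 * real m + 3) * sin x ^ (2 * m + 3) - (2 * real m + 2) * sin x ^ (2 * m + 1)"
    proof -
      have "sin x ^ (2 * m + 3) = sin x ^ (2 * m + 1) * sin x ^ 2"
        by (simp add: power_add power2_eq_square power3_eq_cube)
      thus ?thesis unfolding cos_squared_eq by (simp add: algebra_simps)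
    qed
    finally show "((\<lambda>x. - cos x * sin x ^ (2 * m + 2)) has_vector_derivative
        (2 * real m + 3) * sin x ^ (2 * m + 3) - (2 * real m + 2) * sin x ^ (2 * m + 1)) (at x within {0..pi / 2})"
      by (simp add: has_real_derivative_iff_has_vector_derivative)
  qed simp
  moreover have "(2 * real m + 2) * (1 / (2 * real (Suc m) * central (Suc m))) = 1 / central (Suc m)"
  proof -
    have "2 * real m + 2 = 2 * real (Suc m)" by simp
    thus ?thesis by (simp del: of_nat_Suc)
  qed
  ultimately have "((\<lambda>x. (2 * real m + 3) * sin x ^ (2 * m + 3)) has_integral
      ((- cos (pi / 2) * sin (pi / 2) ^ (2 * m + 2) - (- cos 0 * sin 0 ^ (2 * m + 2))) + 1 / central (Suc m))) {0..pi / 2}"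
    using has_integral_add[OF _ has_integral_mult_right[OF Suc, of "2 * real m + 2"]] by fastforce
  hence "((\<lambda>x. (2 * real m + 3) * sin x ^ (2 * m + 3)) has_integral 1 / central (Suc m)) {0..pi / 2}"
    by simp
  from has_integral_mult_right[OF this, of "1 / (2 * real m + 3)"]
  have "((\<lambda>x. sin x ^ (2 * m + 3)) has_integral 1 / ((2 * real m + 3) * central (Suc m))) {0..pi / 2}"
    by (simp add: add_eq_0_iff)
  moreover have "2 * real (Suc (Suc m)) * central (Suc (Suc m)) = (2 * real m + 3) * central (Suc m)"
    by (subst central_Suc) (simp add: field_simps)
  ultimately show ?case by (simp add: eval_nat_numeral)
qed

section \<open>The integral of \<open>x ^ 2 / sin x\<close> and the central series\<close>

text \<open>At 0 the convention for division by zero gives 0, which is also the limit, so the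
  function is continuous there.\<close>

definition square_over_sin :: "real \<Rightarrow> real" where
  "square_over_sin x = x ^ 2 / sin x"

lemma square_over_sin_0 [simp]: "square_over_sin 0 = 0"
  by (simp add: square_over_sin_def)

lemma continuous_on_square_over_sin: "continuous_on {0..pi / 2} square_over_sin"
  unfolding continuous_on_eq_continuous_within
proof
  fix x :: real assume x: "x \<in> {0..pi / 2}"
  show "continuous (at x within {0..pi / 2}) square_over_sin"
  proof (cases "x = 0")
    case False
    hence "sin x \<noteq> 0" using x sin_pos_half[of x] by auto
    thus ?thesis unfolding square_over_sin_def[abs_def] by (intro continuous_intros)
  next
    case True
    have "(square_over_sin \<longlongrightarrow> 0) (at 0 within {0..pi / 2})"
    proof (rule Lim_null_comparison)
      show "\<forall>\<^sub>F x in at 0 within {0..pi / 2}. norm (square_over_sin x) \<le> pi / 2 * x"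
      proof (rule eventually_at_filter[THEN iffD2], intro always_eventually allI impI)
        fix x :: real assume x: "x \<noteq> 0" "x \<in> {0..pi / 2}"
        hence s: "sin x > 0" by (intro sin_pos_half) auto
        have "x * x \<le> pi / 2 * x * sin x"
          using mult_left_mono[OF le_pi_half_sin[of x], of x] x by (simp add: mult_ac)
        thus "norm (square_over_sin x) \<le> pi / 2 * x"
          using s by (simp add: square_over_sin_def power2_eq_square divide_le_eq)
      qed
      have "((\<lambda>x. pi / 2 * x) \<longlongrightarrow> pi / 2 * 0) (at 0 within {0..pi / 2})"
        by (intro tendsto_intros)
      thus "((\<lambda>x. pi / 2 * x) \<longlongrightarrow> 0) (at 0 within {0..pi / 2})" by simp
    qed
    thus ?thesis using True by (simp add: continuous_within)
  qed
qed

definition sq_sin_integral :: real where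
  "sq_sin_integral = integral {0..pi / 2} square_over_sin"

lemma has_integral_square_over_sin: "(square_over_sin has_integral sq_sin_integral) {0..pi / 2}"
  unfolding sq_sin_integral_def
  by (intro integrable_integral integrable_continuous_interval continuous_on_square_over_sin)

text \<open>The finite expansion of \<open>x ^ 2\<close> in powers of \<open>sin x\<close> is
  divided by \<open>sin x\<close> and integrated. Squeezing the integrated remainder avoids
  interchanging a series with an integral.\<close>

lemma central_series_sums: "(\<lambda>m. 1 / (real (Suc m) ^ 3 * central (Suc m) ^ 2)) sums (4 * sq_sin_integral)"
proof -
  define T where "T M = (\<Sum>m<M. 1 / (4 * real (Suc m) ^ 3 * central (Suc m) ^ 2))" for M
  have int: "((\<lambda>x. arcsin_rem M x / sin x) has_integral (sq_sin_integral - T M)) {0..pi / 2}" for M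
  proof -
    have "((\<lambda>x. square_over_sin x - (\<Sum>m<M. 1 / (2 * real (Suc m) ^ 2 * central (Suc m)) * sin x ^ (2 * m + 1)))
       has_integral (sq_sin_integral - (\<Sum>m<M. 1 / (2 * real (Suc m) ^ 2 * central (Suc m))
          * (1 / (2 * real (Suc m) * central (Suc m)))))) {0..pi / 2}"
      by (intro has_integral_diff has_integral_sum has_integral_mult_right sin_odd_power_integral
          has_integral_square_over_sin) auto
    also have "(\<Sum>m<M. 1 / (2 * real (Suc m) ^ 2 * central (Suc m)) * (1 / (2 * real (Suc m) * central (Suc m)))) = T M"
      unfolding T_def by (intro sum.cong refl) (simp add: power2_eq_square power3_eq_cube mult_ac)
    also have "(\<lambda>x. square_over_sin x - (\<Sum>m<M. 1 / (2 * real (Suc m) ^ 2 * central (Suc m)) * sin x ^ (2 * m + 1)))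
        = (\<lambda>x. arcsin_rem M x / sin x)"
    proof
      fix x :: real
      show "square_over_sin x - (\<Sum>m<M. 1 / (2 * real (Suc m) ^ 2 * central (Suc m)) * sin x ^ (2 * m + 1))
        = arcsin_rem M x / sin x"
        \<comment> \<open>Where \<open>sin x = 0\<close>, division by zero and the odd powers make
          both sides 0.\<close>
        by (cases "sin x = 0")
           (simp_all add: square_over_sin_def arcsin_rem_def diff_divide_distrib sum_divide_distrib)
    qed
    finally show ?thesis .
  qed
  have lower: "T M \<le> sq_sin_integral" for M
  proof -
    have "0 \<le> arcsin_rem M x / sin x" if "x \<in> {0..pi / 2}" for x
      using that by (intro divide_nonneg_nonneg arcsin_rem_nonneg sin_ge_zero) auto
    from has_integral_nonneg[OF int this] show ?thesis by simp
  qed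
  \<comment> \<open>The integrand is at most \<open>pi / 2 * arcsin_rem' M x\<close>, whose integral
    is \<open>pi / 2\<close> times the remainder at \<open>pi / 2\<close>.\<close>
  have upper: "sq_sin_integral - T M \<le> pi / 2 * (pi * central M / norm_factor M)" for M
  proof -
    have "(arcsin_rem' M has_integral (arcsin_rem M (pi / 2) - arcsin_rem M 0)) {0..pi / 2}"
      by (intro fundamental_theorem_of_calculus)
         (auto intro: has_field_derivative_at_within[OF arcsin_rem_deriv]
            simp flip: has_real_derivative_iff_has_vector_derivative)
    from has_integral_mult_right[OF this, of "pi / 2"]
    have "((\<lambda>x. pi / 2 * arcsin_rem' M x) has_integral (pi / 2 * arcsin_rem M (pi / 2))) {0..pi / 2}"
      by simp
    moreover have "arcsin_rem M x / sin x \<le> pi / 2 * arcsin_rem' M x" if x: "x \<in> {0..pi / 2}" for x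
    proof (cases "x = 0")
      case False
      hence s: "sin x > 0" using x by (intro sin_pos_half) auto
      have "arcsin_rem M x \<le> x * arcsin_rem' M x" using x by (intro arcsin_rem_le) auto
      also have "\<dots> \<le> pi / 2 * sin x * arcsin_rem' M x"
        using x by (intro mult_right_mono le_pi_half_sin arcsin_rem'_nonneg) auto
      finally show ?thesis using s by (simp add: divide_le_eq mult_ac)
    qed simp
    ultimately have "sq_sin_integral - T M \<le> pi / 2 * arcsin_rem M (pi / 2)"
      by (intro has_integral_le[OF int])
    also have "\<dots> \<le> pi / 2 * (pi * central M / norm_factor M)"
      by (intro mult_left_mono arcsin_rem_pi_half_le) simp
    finally show ?thesis .
  qed
  have lim: "(\<lambda>M. sq_sin_integral - pi / 2 * (pi * central M / norm_factor M)) \<longlonglongrightarrow> sq_sin_integral - pi / 2 * (pi * 0 / (2 / pi))"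
    by (intro tendsto_intros central_tendsto norm_factor_tendsto) simp
  have "T \<longlonglongrightarrow> sq_sin_integral"
  proof (rule tendsto_sandwich[OF _ _ _ tendsto_const])
    show "\<forall>\<^sub>F M in sequentially. sq_sin_integral - pi / 2 * (pi * central M / norm_factor M) \<le> T M"
      using upper by (intro always_eventually allI) (simp only: diff_le_eq add.commute)
    show "\<forall>\<^sub>F M in sequentially. T M \<le> sq_sin_integral"
      using lower by (intro always_eventually allI)
    show "(\<lambda>M. sq_sin_integral - pi / 2 * (pi * central M / norm_factor M)) \<longlonglongrightarrow> sq_sin_integral"
      using lim by simp
  qed
  hence "(\<lambda>m. 1 / (4 * real (Suc m) ^ 3 * central (Suc m) ^ 2)) sums sq_sin_integral"
    by (simp add: sums_def T_def[abs_def])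
  from sums_mult[OF this, of 4] show ?thesis by simp
qed

section \<open>Evaluation of the integral by odd sines\<close>

lemma square_sin_integral:
  "((\<lambda>x. x ^ 2 * sin ((2 * real j + 1) * x)) has_integral
     (pi * (-1) ^ j / (2 * real j + 1) ^ 2 - 2 / (2 * real j + 1) ^ 3)) {0..pi / 2}"
proof -
  define m where "m = 2 * real j + 1"
  have m: "m \<noteq> 0" unfolding m_def by linarith
  \<comment> \<open>Two integrations by parts; the upper endpoint gives the Catalan term and the
    lower one the cube.\<close>
  let ?F = "\<lambda>x. - (x ^ 2) * cos (m * x) / m + 2 * x * sin (m * x) / m ^ 2 + 2 * cos (m * x) / m ^ 3"
  have "((\<lambda>x. x ^ 2 * sin (m * x)) has_integral (?F (pi / 2) - ?F 0)) {0..pi / 2}"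
  proof (intro fundamental_theorem_of_calculus)
    fix x :: real
    have "(?F has_real_derivative x ^ 2 * sin (m * x)) (at x within {0..pi / 2})"
      using m by (auto intro!: derivative_eq_intros simp: field_simps power2_eq_square power3_eq_cube)
    thus "(?F has_vector_derivative x ^ 2 * sin (m * x)) (at x within {0..pi / 2})"
      by (simp add: has_real_derivative_iff_has_vector_derivative)
  qed simp
  moreover have arg: "m * (pi / 2) = real j * pi + pi / 2" by (simp add: m_def field_simps)
  have "cos (m * (pi / 2)) = 0" "sin (m * (pi / 2)) = (-1) ^ j"
    unfolding arg by (simp_all add: cos_add sin_add cos_npi)
  ultimately show ?thesis by (simp add: m_def)
qed

text \<open>The finite form of \<open>1 / sin x\<close> as a sum of odd sines, with error
  \<open>cos (2 * N * x) / sin x\<close>; the product formula for sines makes it telescope.\<close>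

lemma sin_odd_kernel:
  fixes x :: real
  shows "sin x * (\<Sum>j<N. 2 * sin ((2 * real j + 1) * x)) = 1 - cos (2 * real N * x)"
proof (induction N)
  case (Suc N)
  have a: "2 * real N * x = (2 * real N + 1) * x - x" "2 * real (Suc N) * x = (2 * real N + 1) * x + x"
    by (simp_all add: algebra_simps)
  have "cos (2 * real N * x) - cos (2 * real (Suc N) * x) = 2 * sin x * sin ((2 * real N + 1) * x)"
    unfolding a cos_diff cos_add by simp
  thus ?case using Suc by (simp add: distrib_left)
qed simp

text \<open>A quantitative Riemann-Lebesgue estimate: one integration by parts gains
  \<open>1 / (2 * N)\<close>, and the boundary terms vanish because \<open>sin (N * pi) = 0\<close>
  and \<open>square_over_sin 0 = 0\<close>.\<close>

lemma square_over_sin_oscillation: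
  assumes "N > 0"
  shows "\<exists>J. ((\<lambda>x. square_over_sin x * cos (2 * real N * x)) has_integral J) {0..pi / 2} \<and>
             \<bar>J\<bar> \<le> (pi + pi ^ 2 / 4) / (2 * real N) * (pi / 2)"
proof -
  define w where "w = 2 * real N"
  have w: "w > 0" using assms by (simp add: w_def)
  define f' where "f' x = (2 * x * sin x - x ^ 2 * cos x) / sin x ^ 2" for x :: real
  let ?J = "integral {0..pi / 2} (\<lambda>x. square_over_sin x * cos (w * x))"
  have J: "((\<lambda>x. square_over_sin x * cos (w * x)) has_integral ?J) {0..pi / 2}"
    by (intro integrable_integral integrable_continuous_interval continuous_intros continuous_on_square_over_sin)
  have "((\<lambda>x. f' x * (sin (w * x) / w) + square_over_sin x * cos (w * x)) has_integral
      (square_over_sin (pi / 2) * (sin (w * (pi / 2)) / w) - square_over_sin 0 * (sin (w * 0) / w))) {0..pi / 2}"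
  \<comment> \<open>The interior version needs no derivative at 0, where the formula for
    \<open>f'\<close> only has a default value.\<close>
  proof (rule fundamental_theorem_of_calculus_interior)
    show "continuous_on {0..pi / 2} (\<lambda>x. square_over_sin x * (sin (w * x) / w))"
      using w by (intro continuous_intros continuous_on_square_over_sin) simp
    fix x assume x: "x \<in> {0<..<pi / 2}"
    hence s: "sin x > 0" by (intro sin_pos_half) auto
    have "(square_over_sin has_real_derivative f' x) (at x)"
      unfolding square_over_sin_def[abs_def] f'_def using s
      by (auto intro!: derivative_eq_intros simp: power2_eq_square)
    moreover have "((\<lambda>x. sin (w * x) / w) has_real_derivative cos (w * x)) (at x)"
      using w by (auto intro!: derivative_eq_intros)
    ultimately have "((\<lambda>x. square_over_sin x * (sin (w * x) / w)) has_real_derivative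
        (f' x * (sin (w * x) / w) + cos (w * x) * square_over_sin x)) (at x)"
      by (rule DERIV_mult)
    thus "((\<lambda>x. square_over_sin x * (sin (w * x) / w)) has_vector_derivative
        (f' x * (sin (w * x) / w) + square_over_sin x * cos (w * x))) (at x)"
      by (simp add: has_real_derivative_iff_has_vector_derivative mult.commute)
  qed simp
  moreover have "w * (pi / 2) = real N * pi" by (simp add: w_def)
  hence "sin (w * (pi / 2)) = 0" by simp
  ultimately have "((\<lambda>x. f' x * (sin (w * x) / w) + square_over_sin x * cos (w * x)) has_integral 0) {0..pi / 2}"
    by simp
  from has_integral_diff[OF this J]
  have minus: "((\<lambda>x. f' x * (sin (w * x) / w)) has_integral - ?J) {0..pi / 2}" by simp
  have bound: "norm (f' x * (sin (w * x) / w)) \<le> (pi + pi ^ 2 / 4) / w" if x: "x \<in> {0..pi / 2}" for x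
  proof -
    have "\<bar>f' x\<bar> \<le> pi + pi ^ 2 / 4"
    proof (cases "x = 0")
      case False
      hence s: "sin x > 0" using x by (intro sin_pos_half) auto
      \<comment> \<open>In terms of \<open>r\<close>, at most \<open>pi / 2\<close> by Jordan's
        inequality, \<open>f'\<close> is \<open>2 * r - r ^ 2 * cos x\<close>.\<close>
      define r where "r = x / sin x"
      have r: "0 \<le> r" "r \<le> pi / 2"
        using le_pi_half_sin[of x] x s by (auto simp: r_def divide_le_eq)
      have "f' x = 2 * r - r ^ 2 * cos x"
        using s by (simp add: f'_def r_def field_simps power2_eq_square)
      moreover have "\<bar>r ^ 2 * cos x\<bar> \<le> (pi / 2) ^ 2 * 1"
        unfolding abs_mult using r by (intro mult_mono) (auto intro!: power_mono)
      ultimately show ?thesis using r by (simp add: power_divide)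
    qed (simp add: f'_def)
    moreover have "\<bar>sin (w * x) / w\<bar> \<le> 1 / w"
      using w by (simp add: divide_right_mono)
    ultimately have "\<bar>f' x\<bar> * \<bar>sin (w * x) / w\<bar> \<le> (pi + pi ^ 2 / 4) * (1 / w)"
      by (intro mult_mono) auto
    thus ?thesis by (simp add: abs_mult)
  qed
  have "norm (- ?J) \<le> (pi + pi ^ 2 / 4) / w * measure lborel (cbox 0 (pi / 2))"
    using minus bound w by (intro has_integral_bound) auto
  hence "\<bar>?J\<bar> \<le> (pi + pi ^ 2 / 4) / w * (pi / 2)" by simp
  thus ?thesis using J unfolding w_def by blast
qed

lemma odd_cubes_sum: "(\<Sum>j<N. 1 / (2 * real j + 1) ^ 3) = harmonic_order 3 (2 * N) - harmonic_order 3 N / 8"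
proof (induction N)
  case 0
  show ?case by (simp add: harmonic_order_def)
next
  case (Suc N)
  have e: "2 * Suc N = Suc (Suc (2 * N))" by simp
  have "1 / (2 * real N + 2) ^ 3 = 1 / (real N + 1) ^ 3 / 8"
    by (simp add: divide_simps power3_eq_cube) (simp add: algebra_simps)
  thus ?case using Suc unfolding e harmonic_order_Suc by (simp add: add_divide_distrib add_ac)
qed

lemma catalan_sums: "(\<lambda>j. (-1) ^ j / (2 * real j + 1) ^ 2) sums Catalan_const"
proof -
  have "(\<lambda>k. 1 / (2 * real k + 1) ^ 2) \<longlonglongrightarrow> 0" by real_asymp
  hence "summable (\<lambda>k. (-1) ^ k * (1 / (2 * real k + 1) ^ 2))"
    by (rule summable_Leibniz'(1)) (auto intro!: frac_le power_mono)
  from summable_sums[OF this] show ?thesis by (simp add: Catalan_const_def add.commute)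
qed

text \<open>By \<open>sin_odd_kernel\<close>, replacing \<open>1 / sin x\<close> by \<open>N\<close>
  odd sines costs only the oscillating integral. The limits of the sums are
  \<open>2 * pi * Catalan_const\<close> and 4 times the odd cubes, that is
  \<open>4 * (7 / 8) * zeta3\<close>.\<close>

lemma sq_sin_integral_eq: "sq_sin_integral = 2 * pi * Catalan_const - 7 / 2 * zeta3"
proof -
  define T where "T N = (\<Sum>j<N. 2 * (pi * (-1) ^ j / (2 * real j + 1) ^ 2 - 2 / (2 * real j + 1) ^ 3))" for N
  have bound: "\<bar>T N - sq_sin_integral\<bar> \<le> (pi + pi ^ 2 / 4) / (2 * real N) * (pi / 2)" if "N > 0" for N
  proof -
    from square_over_sin_oscillation[OF that] obtain J where
      J: "((\<lambda>x. square_over_sin x * cos (2 * real N * x)) has_integral J) {0..pi / 2}"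
      and le: "\<bar>J\<bar> \<le> (pi + pi ^ 2 / 4) / (2 * real N) * (pi / 2)" by blast
    have "((\<lambda>x. square_over_sin x - (\<Sum>j<N. 2 * (x ^ 2 * sin ((2 * real j + 1) * x))))
        has_integral (sq_sin_integral - T N)) {0..pi / 2}"
      unfolding T_def
      by (intro has_integral_diff has_integral_sum has_integral_mult_right square_sin_integral
          has_integral_square_over_sin) auto
    moreover have "square_over_sin x - (\<Sum>j<N. 2 * (x ^ 2 * sin ((2 * real j + 1) * x)))
        = square_over_sin x * cos (2 * real N * x)" if x: "x \<in> {0..pi / 2}" for x
    proof (cases "x = 0")
      case False
      hence s: "sin x > 0" using x by (intro sin_pos_half) auto
      have "(\<Sum>j<N. 2 * (x ^ 2 * sin ((2 * real j + 1) * x)))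
          = square_over_sin x * (sin x * (\<Sum>j<N. 2 * sin ((2 * real j + 1) * x)))"
        using s by (simp add: square_over_sin_def sum_distrib_left mult_ac)
      thus ?thesis unfolding sin_odd_kernel by (simp add: algebra_simps)
    qed simp
    ultimately have "((\<lambda>x. square_over_sin x * cos (2 * real N * x)) has_integral (sq_sin_integral - T N)) {0..pi / 2}"
      by (rule has_integral_eq[rotated])
    hence "sq_sin_integral - T N = J" using J by (rule has_integral_unique)
    thus ?thesis using le by (simp add: abs_minus_commute)
  qed
  have "(\<lambda>N. T N - sq_sin_integral) \<longlonglongrightarrow> 0"
  proof (rule Lim_null_comparison)
    show "\<forall>\<^sub>F N in sequentially. norm (T N - sq_sin_integral) \<le> (pi + pi ^ 2 / 4) / (2 * real N) * (pi / 2)"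
      using eventually_gt_at_top[of 0] by eventually_elim (use bound in auto)
    have "(\<lambda>N. (pi + pi ^ 2 / 4) * (1 / (2 * real N)) * (pi / 2)) \<longlonglongrightarrow> (pi + pi ^ 2 / 4) * 0 * (pi / 2)"
      by (intro tendsto_mult tendsto_const) real_asymp
    thus "(\<lambda>N. (pi + pi ^ 2 / 4) / (2 * real N) * (pi / 2)) \<longlonglongrightarrow> 0" by simp
  qed
  hence lim: "T \<longlonglongrightarrow> sq_sin_integral" by (simp add: LIM_zero_iff)
  have T_eq: "T N = 2 * pi * (\<Sum>j<N. (-1) ^ j / (2 * real j + 1) ^ 2)
      - 4 * (harmonic_order 3 (2 * N) - harmonic_order 3 N / 8)" for N
    unfolding T_def odd_cubes_sum[symmetric]
    by (simp add: sum_distrib_left sum_subtractf[symmetric] algebra_simps)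
  have "(\<lambda>N. 2 * pi * (\<Sum>j<N. (-1) ^ j / (2 * real j + 1) ^ 2) - 4 * (harmonic_order 3 (2 * N) - harmonic_order 3 N / 8))
      \<longlonglongrightarrow> 2 * pi * Catalan_const - 4 * (zeta3 - zeta3 / 8)"
    by (intro tendsto_intros catalan_sums[unfolded sums_def] harmonic_order_3_tendsto harmonic_order_3_tendsto_double) simp
  from LIMSEQ_unique[OF lim this[folded T_eq]] show ?thesis by simp
qed

theorem theorem1p1:
  shows "(\<lambda>k. (- 1) ^ Suc k * (4 * real (Suc k) + 1)
             * (pochhammer (1 / 2 :: real) (Suc k) ^ 3 / pochhammer (1 :: real) (Suc k) ^ 3)
             * harmonic_order 3 (2 * Suc k))
         sums (15 * zeta3 / (4 * pi) - 2 * Catalan_const)"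
proof -
  have "(\<lambda>k. bauer k * (8 * harmonic_order 3 (2 * k))) sums
      (2 / pi * (zeta3 - 4 * (2 * pi * Catalan_const - 7 / 2 * zeta3)))"
    using bauer_harmonic_sums[OF central_series_sums] unfolding sq_sin_integral_eq .
  from sums_mult[OF this, of "1 / 8"]
  have "(\<lambda>k. bauer k * harmonic_order 3 (2 * k)) sums
      (1 / 8 * (2 / pi * (zeta3 - 4 * (2 * pi * Catalan_const - 7 / 2 * zeta3))))"
    by simp
  also have "1 / 8 * (2 / pi * (zeta3 - 4 * (2 * pi * Catalan_const - 7 / 2 * zeta3)))
      = 15 * zeta3 / (4 * pi) - 2 * Catalan_const"
    by (simp add: field_simps)
  finally have "(\<lambda>k. bauer (Suc k) * harmonic_order 3 (2 * Suc k)) sums (15 * zeta3 / (4 * pi) - 2 * Catalan_const)"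
    \<comment> \<open>The shift to start at 1 is free: \<open>harmonic_order 3 0 = 0\<close> kills
      the term at 0.\<close>
    by (subst sums_Suc_iff) (simp add: harmonic_order_def)
  moreover have "bauer (Suc k) = (- 1) ^ Suc k * (4 * real (Suc k) + 1)
      * (pochhammer (1 / 2 :: real) (Suc k) ^ 3 / pochhammer (1 :: real) (Suc k) ^ 3)" for k
    by (simp only: bauer_def central_def power_divide pochhammer_fact)
  ultimately show ?thesis by simp
qed

end
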